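(* Let $G$ be a finite abstract simplicial complex with $n$ sets. Then its counting matrix $K$, i.e. the real symmetric $n\times n$ matrix with entries $K(x,y)=|W^-(x)\cap W^-(y)|$ for $x,y\in G$, is positive definite.
   Context: A finite abstract simplicial complex $G$ is a finite set of non-empty finite sets that is closed under taking non-empty subsets (the empty set is not an element of $G$). For $x\in G$, the core of $x$ is $W^-(x)=\{u\in G : u\subseteq x\}$, i.e. the set of all non-empty subsets of $x$. The counting matrix $K$ of $G$ has its rows and columns indexed by the elements of $G$ (in some fixed order, the same for rows and columns), with $K(x,y)=|W^-(x)\cap W^-(y)|=2^{|x\cap y|}-1$. *)

theory Defs
  imports Complex_Main "Jordan_Normal_Form.Matrix"
begin

definition finite_simplicial_complex :: "'a set set \<Rightarrow> bool" where
  "finite_simplicial_complex G \<longleftrightarrow>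
     finite G \<and> (\<forall>x\<in>G. finite x \<and> x \<noteq> {}) \<and>
     (\<forall>x\<in>G. \<forall>y. y \<noteq> {} \<and> y \<subseteq> x \<longrightarrow> y \<in> G)"

definition core :: "'a set set \<Rightarrow> 'a set \<Rightarrow> 'a set set" where
  "core G x = {u \<in> G. u \<subseteq> x}"

text \<open>The list \<open>xs\<close> is an enumeration of \<open>G\<close> without repetitions; it fixes
  the order of both the rows and the columns.\<close>

definition counting_matrix :: "'a set set \<Rightarrow> 'a set list \<Rightarrow> real mat" where
  "counting_matrix G xs =
     mat (length xs) (length xs)
       (\<lambda>(i, j). real (card (core G (xs ! i) \<inter> core G (xs ! j))))"

lemma card_core_Int_core:
  assumes "finite_simplicial_complex G" and "x \<in> G" and "y \<in> G"
  shows "card (core G x \<inter> core G y) = 2 ^ card (x \<inter> y) - 1"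
proof -
  have "core G x \<inter> core G y = Pow (x \<inter> y) - {{}}"
    using assms unfolding finite_simplicial_complex_def core_def by blast
  moreover have "finite (x \<inter> y)"
    using assms unfolding finite_simplicial_complex_def by blast
  ultimately show ?thesis by (simp add: card_Pow del: Pow_Int_eq)
qed

definition positive_definite :: "real mat \<Rightarrow> bool" where
  "positive_definite A \<longleftrightarrow>
     square_mat A \<and> transpose_mat A = A \<and>
     (\<forall>v \<in> carrier_vec (dim_row A). v \<noteq> 0\<^sub>v (dim_row A) \<longrightarrow> v \<bullet> (A *\<^sub>v v) > 0)"

end

theory Submission
  imports Defs
begin

text \<open>
  Counting the elements of a core one at a time exhibits \<open>K\<close> as a Gram matrix. Let
  \<open>Z(u, x) = 1\<close> if \<open>u \<subseteq> x\<close> and \<open>Z(u, x) = 0\<close> otherwise. An element \<open>u\<close> of \<open>G\<close> lies in both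
  cores of \<open>x\<close> and \<open>y\<close> exactly if \<open>Z(u, x) Z(u, y) = 1\<close>, so \<open>K = Z\<^sup>T Z\<close>
  (\<open>card_core_Int_core_eq_sum\<close>) and the quadratic form of \<open>K\<close> at \<open>v\<close> is the sum of
  squares \<open>\<Sum>u. (\<Sum>x \<supseteq> u. v x)\<^sup>2\<close> (\<open>counting_matrix_quadratic_form\<close>).

  The form is definite because \<open>Z\<close> is unitriangular for inclusion, hence injective: if \<open>v\<close>
  does not vanish, choose \<open>x\<close> maximal among the sets where \<open>v\<close> does not vanish; the sum
  over all supersets of \<open>x\<close> is then \<open>v x\<close> alone (\<open>zero_if_upper_sums_zero\<close>).
\<close>

lemma card_core_Int_core_eq_sum:
  assumes "finite G"
  shows "real (card (core G x \<inter> core G y)) = (\<Sum>u\<in>G. of_bool (u \<subseteq> x) * of_bool (u \<subseteq> y))"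
proof -
  have "core G x \<inter> core G y = G \<inter> {u. u \<subseteq> x \<and> u \<subseteq> y}"
    by (auto simp: core_def)
  then show ?thesis
    using assms by (simp add: of_bool_conj[symmetric])
qed

lemma counting_matrix_quadratic_form:
  assumes "finite G" and v: "v \<in> carrier_vec (length xs)"
  shows "v \<bullet> (counting_matrix G xs *\<^sub>v v) =
    (\<Sum>u\<in>G. (\<Sum>i<length xs. of_bool (u \<subseteq> xs ! i) * v $ i)\<^sup>2)"
proof -
  let ?N = "{..<length xs}"
  let ?z = "\<lambda>u i. of_bool (u \<subseteq> xs ! i) :: real"
  have "v \<bullet> (counting_matrix G xs *\<^sub>v v) =
      (\<Sum>i\<in>?N. v $ i * (\<Sum>j\<in>?N. (\<Sum>u\<in>G. ?z u i * ?z u j) * v $ j))"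
    using v by (simp add: counting_matrix_def scalar_prod_def atLeast0LessThan
        card_core_Int_core_eq_sum[OF assms(1)])
  also have "\<dots> = (\<Sum>i\<in>?N. \<Sum>j\<in>?N. \<Sum>u\<in>G. (?z u i * v $ i) * (?z u j * v $ j))"
    by (simp add: sum_distrib_left sum_distrib_right mult_ac)
  also have "\<dots> = (\<Sum>i\<in>?N. \<Sum>u\<in>G. \<Sum>j\<in>?N. (?z u i * v $ i) * (?z u j * v $ j))"
    by (intro sum.cong refl sum.swap)
  also have "\<dots> = (\<Sum>u\<in>G. \<Sum>i\<in>?N. \<Sum>j\<in>?N. (?z u i * v $ i) * (?z u j * v $ j))"
    by (rule sum.swap)
  also have "\<dots> = (\<Sum>u\<in>G. (\<Sum>i\<in>?N. ?z u i * v $ i)\<^sup>2)"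
    by (simp only: power2_eq_square sum_product)
  finally show ?thesis .
qed

text \<open>
  At a maximal point of the support of \<open>f\<close> the upper sum has a single term. This is the
  injectivity of the zeta matrix of a finite poset; its points carry labels from \<open>I\<close> because
  vector coordinates are numbered, while the order lives on the sets that they stand for.
\<close>

lemma zero_if_upper_sums_zero:
  fixes p :: "'i \<Rightarrow> 'p::order" and f :: "'i \<Rightarrow> 'b::semiring_1"
  assumes "finite I" and "inj_on p I"
    and zero: "\<And>i. i \<in> I \<Longrightarrow> (\<Sum>j\<in>I. of_bool (p i \<le> p j) * f j) = 0"
    and "i \<in> I"
  shows "f i = 0"
proof (rule ccontr)
  let ?S = "{j \<in> I. f j \<noteq> 0}"
  assume "f i \<noteq> 0"
  then have "finite (p ` ?S)" "p ` ?S \<noteq> {}"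
    using assms by auto
  then obtain m where m: "m \<in> I" "f m \<noteq> 0" and max: "\<And>j. j \<in> ?S \<Longrightarrow> p m \<le> p j \<Longrightarrow> p m = p j"
    using finite_has_maximal[of "p ` ?S"] by auto
  have "(\<Sum>j\<in>I. of_bool (p m \<le> p j) * f j) = (\<Sum>j\<in>I. if j = m then f j else 0)"
    using max m(1) inj_onD[OF assms(2)] by (intro sum.cong) fastforce+
  also have "\<dots> = f m"
    using assms(1) m(1) by simp
  finally show False
    using zero m by simp
qed

theorem theorem3:
  fixes G :: "'a set set" and xs :: "'a set list" and n :: nat
  assumes "finite_simplicial_complex G"
    and "card G = n"
    and "distinct xs" and "set xs = G"
  shows "counting_matrix G xs \<in> carrier_mat n n \<and> positive_definite (counting_matrix G xs)"
proof
  let ?K = "counting_matrix G xs"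
  have n: "length xs = n"
    using assms distinct_card by fastforce
  then show K: "?K \<in> carrier_mat n n"
    by (simp add: counting_matrix_def)
  have fin: "finite G"
    using assms(4) by auto
  have "v \<bullet> (?K *\<^sub>v v) > 0" if v: "v \<in> carrier_vec n" "v \<noteq> 0\<^sub>v n" for v
  proof -
    let ?s = "\<lambda>u. \<Sum>i<n. of_bool (u \<subseteq> xs ! i) * v $ i"
    have form: "v \<bullet> (?K *\<^sub>v v) = (\<Sum>u\<in>G. (?s u)\<^sup>2)"
      using counting_matrix_quadratic_form[OF fin, of v xs] v(1) n by simp
    have "\<exists>u\<in>G. ?s u \<noteq> 0"
    proof (rule ccontr)
      assume "\<not> (\<exists>u\<in>G. ?s u \<noteq> 0)"
      then have "?s (xs ! i) = 0" if "i < n" for i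
        using that assms(4) n nth_mem by blast
      moreover have "inj_on ((!) xs) {..<n}"
        using assms(3) n by (simp add: inj_on_nth)
      ultimately have "v $ i = 0" if "i < n" for i
        using zero_if_upper_sums_zero[of "{..<n}" "(!) xs" "($) v" i] that by simp
      then show False
        using v by (auto intro: eq_vecI)
    qed
    then obtain u where "u \<in> G" "?s u \<noteq> 0"
      by blast
    then have "(\<Sum>u\<in>G. (?s u)\<^sup>2) > 0"
      using fin by (intro sum_pos2[of G u]) auto
    then show ?thesis
      using form by simp
  qed
  moreover have "transpose_mat ?K = ?K"
    by (rule eq_matI) (auto simp: counting_matrix_def Int_commute)
  ultimately show "positive_definite ?K"
    using K by (auto simp: positive_definite_def)
qed

end
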